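(* For any function $w\in\mathbb{C}^\alpha[0,1]$, there exist constants $C_w$ and $D_w$ depending only on $w$ such that $$\inf\{\|h\|_{\mathbb{H}^a}^2:\ \|w-h\|_\infty\le C_wa^{-\alpha}\}\le D_wa,\qquad\text{as } a\to\infty,$$ where the infimum is over $h\in\mathbb{H}^a$.
   Context: Here $\alpha>0$ and $a>0$. $\mathbb{H}^a$ is the reproducing kernel Hilbert space, with norm $\|\cdot\|_{\mathbb{H}^a}$, of the centered Gaussian process $W^a=(W^a_t:t\in[0,1])$ with squared exponential periodic covariance kernel $G_a(t,t')=\exp\{-4a^2\sin^2(\pi t-\pi t')\}$. $\|\cdot\|_\infty$ is the supremum norm on $[0,1]$. $\mathbb{C}^\alpha[0,1]$ is the $\alpha$-Hölder class on $[0,1]$: with $\alpha_0$ the largest integer strictly smaller than $\alpha$, it consists of the functions $w$ on $[0,1]$ with $|w^{(\alpha_0)}(x)-w^{(\alpha_0)}(y)|\le L_w|x-y|^{\alpha-\alpha_0}$ for all $x,y\in[0,1]$ and some $L_w>0$.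
   Formalization: The formal theorem also assumes that the derivatives of w of orders 0 to α_0 agree at 0 and 1; without this the claim fails, e.g. for α=1, w(x)=x, since every h in H^a has h(0)=h(1). *)

theory Defs
  imports "HOL-Analysis.Analysis"
begin

text \<open>
  Functions on \<open>[0,1]\<close> are represented by total functions \<open>real \<Rightarrow> real\<close>; every notion below
  reads only the values on \<open>[0,1]\<close> (or on the index set \<open>T\<close>).
\<close>

subsection \<open>Hoelder classes on the unit interval\<close>

text \<open>The largest integer strictly smaller than \<open>\<alpha>\<close>, for \<open>\<alpha> > 0\<close>.\<close>

definition holder_order :: "real \<Rightarrow> nat" where
  "holder_order \<alpha> = nat (\<lceil>\<alpha>\<rceil> - 1)"

lemma holder_order_greatest:
  assumes "\<alpha> > 0"
  shows "real (holder_order \<alpha>) < \<alpha>"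
    and "real_of_int k < \<alpha> \<Longrightarrow> k \<le> int (holder_order \<alpha>)"
  using assms unfolding holder_order_def by linarith+

text \<open>Derivatives at the end points 0 and 1 are one-sided.\<close>

definition deriv01 :: "nat \<Rightarrow> (real \<Rightarrow> real) \<Rightarrow> real \<Rightarrow> real" where
  "deriv01 k w = ((\<lambda>f x. vector_derivative f (at x within {0..1})) ^^ k) w"

definition holder_class :: "real \<Rightarrow> (real \<Rightarrow> real) set" where
  "holder_class \<alpha> =
     {w. (\<forall>k<holder_order \<alpha>. \<forall>x\<in>{0..1}. deriv01 k w differentiable (at x within {0..1})) \<and>
         (\<exists>L>0. \<forall>x\<in>{0..1}. \<forall>y\<in>{0..1}.
            \<bar>deriv01 (holder_order \<alpha>) w x - deriv01 (holder_order \<alpha>) w y\<bar>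
              \<le> L * \<bar>x - y\<bar> powr (\<alpha> - real (holder_order \<alpha>)))}"

text \<open>
  The end points 0 and 1 are the same point of the circle: a member of \<open>holder_class \<alpha>\<close> is a
  Hoelder function on the circle iff its derivatives up to order \<open>holder_order \<alpha>\<close> agree at 0
  and 1. All functions in the reproducing kernel Hilbert space of a 1-periodic kernel satisfy
  \<open>h 0 = h 1\<close>, so a function with \<open>w 0 \<noteq> w 1\<close> cannot be approximated uniformly by them.
\<close>

definition matching_endpoints :: "real \<Rightarrow> (real \<Rightarrow> real) \<Rightarrow> bool" where
  "matching_endpoints \<alpha> w \<longleftrightarrow> (\<forall>k\<le>holder_order \<alpha>. deriv01 k w 0 = deriv01 k w 1)"

definition sup_norm01 :: "(real \<Rightarrow> real) \<Rightarrow> ereal" where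
  "sup_norm01 f = (SUP x\<in>{0..1}. ereal \<bar>f x\<bar>)"

subsection \<open>The reproducing kernel Hilbert space of a covariance kernel\<close>

text \<open>
  The space of a centered Gaussian process indexed by \<open>T\<close> with covariance kernel \<open>K\<close> is the
  completion, realised as functions on \<open>T\<close>, of the span of the functions \<open>K s\<close> with \<open>s \<in> T\<close>,
  where the squared norm of \<open>\<Sum>s. c s * K s\<close> is \<open>\<Sum>s. \<Sum>t. c s * c t * K s t\<close>.
  Finite linear combinations are given by finitely supported coefficient functions \<open>c\<close>.
\<close>

definition coeffs_on :: "'a set \<Rightarrow> ('a \<Rightarrow> real) set" where
  "coeffs_on T = {c. finite {s. c s \<noteq> 0} \<and> {s. c s \<noteq> 0} \<subseteq> T}"

definition kernel_comb :: "('a \<Rightarrow> 'a \<Rightarrow> real) \<Rightarrow> ('a \<Rightarrow> real) \<Rightarrow> 'a \<Rightarrow> real" where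
  "kernel_comb K c x = (\<Sum>s | c s \<noteq> 0. c s * K s x)"

definition kernel_comb_norm :: "('a \<Rightarrow> 'a \<Rightarrow> real) \<Rightarrow> ('a \<Rightarrow> real) \<Rightarrow> real" where
  "kernel_comb_norm K c = sqrt (\<Sum>s | c s \<noteq> 0. \<Sum>t | c t \<noteq> 0. c s * c t * K s t)"

text \<open>
  By the reproducing property, a Cauchy sequence of combinations converges pointwise on \<open>T\<close>,
  and its pointwise limit determines the element of the completion.
\<close>

definition rkhs_approx ::
  "('a \<Rightarrow> 'a \<Rightarrow> real) \<Rightarrow> 'a set \<Rightarrow> (nat \<Rightarrow> 'a \<Rightarrow> real) \<Rightarrow> ('a \<Rightarrow> real) \<Rightarrow> bool" where
  "rkhs_approx K T c h \<longleftrightarrow>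
     (\<forall>n. c n \<in> coeffs_on T) \<and>
     (\<forall>e>0. \<exists>N. \<forall>m\<ge>N. \<forall>n\<ge>N. kernel_comb_norm K (\<lambda>s. c m s - c n s) < e) \<and>
     (\<forall>x\<in>T. (\<lambda>n. kernel_comb K (c n) x) \<longlonglongrightarrow> h x)"

definition rkhs :: "('a \<Rightarrow> 'a \<Rightarrow> real) \<Rightarrow> 'a set \<Rightarrow> ('a \<Rightarrow> real) set" where
  "rkhs K T = {h. \<exists>c. rkhs_approx K T c h}"

text \<open>For positive semidefinite \<open>K\<close> the limit exists and does not depend on the sequence.\<close>

definition rkhs_norm :: "('a \<Rightarrow> 'a \<Rightarrow> real) \<Rightarrow> 'a set \<Rightarrow> ('a \<Rightarrow> real) \<Rightarrow> real" where
  "rkhs_norm K T h =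
     (THE r. \<exists>c. rkhs_approx K T c h \<and> (\<lambda>n. kernel_comb_norm K (c n)) \<longlonglongrightarrow> r)"

text \<open>The squared exponential periodic kernel.\<close>

definition sep_kernel :: "real \<Rightarrow> real \<Rightarrow> real \<Rightarrow> real" where
  "sep_kernel a t t' = exp (- 4 * a\<^sup>2 * (sin (pi * t - pi * t'))\<^sup>2)"

end

theory Submission
  imports Defs
begin

text \<open>
  On the circle the kernel is a convolution kernel \<open>K(s - t)\<close>, where
  \<open>K u = exp (- 4 * a\<^sup>2 * (sin (pi * u))\<^sup>2)\<close> is a bump of width \<open>1 / a\<close> and of total mass \<open>Z\<close> of
  order \<open>1 / a\<close>. Let \<open>T\<close> be the convolution with the probability density \<open>K / Z\<close>. An element \<open>T g\<close>
  with \<open>g\<close> bounded by \<open>M\<close> lies in the Hilbert space and has the squared norm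
  \<open>\<integral>\<integral> g s * g t * K(s - t) / Z\<^sup>2 \<le> M\<^sup>2 / Z\<close>, which is of order \<open>a\<close>. So it suffices to
  approximate \<open>w\<close> up to an error of order \<open>a powr (- \<alpha>)\<close> by such a \<open>T g\<close>, with a bound on \<open>g\<close> that
  does not depend on \<open>a\<close>.

  In general \<open>T w\<close> itself is accurate only to order \<open>1 / a\<^sup>2\<close>, even for very smooth \<open>w\<close>.
  Instead, with \<open>n\<close> the Hoelder order and \<open>S = I - T\<close>, the approximation is
  \<open>w - S\<^sup>n\<^sup>+\<^sup>1 w = T (\<Sum>j\<le>n. S\<^sup>j w)\<close> (lemma \<open>minus_residual_power\<close>). Its error
  \<open>S\<^sup>n\<^sup>+\<^sup>1 w\<close> is small because \<open>S\<close> commutes with differentiation and a single \<open>S\<close> multiplies the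
  bound for the derivative by the first absolute moment of the density, of order \<open>1 / a\<close>: every
  derivative of \<open>w\<close> is worth a factor \<open>1 / a\<close>, and the Hoelder condition on the last one is worth
  \<open>a powr (n - \<alpha>)\<close> (lemma \<open>residual_power_le\<close>). This iteration replaces a higher-order kernel, so
  that the required estimates of \<open>K\<close> reduce to its mass and its first absolute moment
  (lemmas \<open>sep_mass_ge\<close> and \<open>sep_kernel_moment\<close>).

  To stay with finite combinations of kernel functions, the integral \<open>T g\<close> is replaced by a Riemann
  sum so fine that it costs another \<open>a powr (- \<alpha>)\<close> in the supremum norm and at most a factor 2 in
  the bound for the squared norm (lemma \<open>discretised_convolution\<close>). For finite combinations the
  abstract norm equals the explicit double sum, as the kernel is positive semidefinite
  (lemmas \<open>rkhs_norm_kernel_comb\<close> and \<open>psd_sep_kernel\<close>).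
\<close>

section \<open>Finite combinations of kernel functions\<close>

text \<open>
  The inner product of the combinations \<open>kernel_comb K c\<close> and \<open>kernel_comb K d\<close>, on the level
  of coefficients.
\<close>

definition kernel_form :: "('a \<Rightarrow> 'a \<Rightarrow> real) \<Rightarrow> ('a \<Rightarrow> real) \<Rightarrow> ('a \<Rightarrow> real) \<Rightarrow> real" where
  "kernel_form K c d = (\<Sum>s | c s \<noteq> 0. \<Sum>t | d t \<noteq> 0. c s * d t * K s t)"

definition psd_kernel :: "('a \<Rightarrow> 'a \<Rightarrow> real) \<Rightarrow> bool" where
  "psd_kernel K \<longleftrightarrow> (\<forall>s t. K s t = K t s) \<and>
     (\<forall>A c. finite A \<longrightarrow> 0 \<le> (\<Sum>s\<in>A. \<Sum>t\<in>A. c s * c t * K s t))"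

lemma kernel_comb_superset:
  assumes "finite A" "{s. c s \<noteq> 0} \<subseteq> A"
  shows "kernel_comb K c x = (\<Sum>s\<in>A. c s * K s x)"
  unfolding kernel_comb_def using assms by (intro sum.mono_neutral_left) auto

lemma kernel_form_superset:
  assumes A: "finite A" "{s. c s \<noteq> 0} \<subseteq> A" "{s. d s \<noteq> 0} \<subseteq> A"
  shows "kernel_form K c d = (\<Sum>s\<in>A. \<Sum>t\<in>A. c s * d t * K s t)"
proof -
  have "(\<Sum>t | d t \<noteq> 0. c s * d t * K s t) = (\<Sum>t\<in>A. c s * d t * K s t)" for s
    using A by (intro sum.mono_neutral_left) auto
  moreover have "(\<Sum>s | c s \<noteq> 0. \<Sum>t\<in>A. c s * d t * K s t) = (\<Sum>s\<in>A. \<Sum>t\<in>A. c s * d t * K s t)"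
    using A by (intro sum.mono_neutral_left) auto
  ultimately show ?thesis
    by (simp add: kernel_form_def)
qed

lemma kernel_comb_norm_eq: "kernel_comb_norm K c = sqrt (kernel_form K c c)"
  by (simp add: kernel_comb_norm_def kernel_form_def)

lemma kernel_form_nonneg:
  assumes "psd_kernel K" "c \<in> coeffs_on T"
  shows "0 \<le> kernel_form K c c"
  using assms unfolding psd_kernel_def coeffs_on_def kernel_form_def by blast

text \<open>
  The reproducing property, for a finite combination in the second argument. It turns pointwise
  convergence into convergence of inner products.
\<close>

lemma kernel_form_eq_comb:
  assumes "c \<in> coeffs_on T" "d \<in> coeffs_on T"
  shows "kernel_form K c d = (\<Sum>s | d s \<noteq> 0. d s * kernel_comb K c s)"
proof -
  let ?A = "{s. c s \<noteq> 0} \<union> {s. d s \<noteq> 0}"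
  have fin: "finite ?A" using assms by (auto simp: coeffs_on_def)
  have "kernel_form K c d = (\<Sum>s\<in>?A. \<Sum>t\<in>?A. c s * d t * K s t)"
    using fin by (intro kernel_form_superset) auto
  also have "\<dots> = (\<Sum>t\<in>?A. \<Sum>s\<in>?A. c s * d t * K s t)"
    by (rule sum.swap)
  also have "\<dots> = (\<Sum>t\<in>?A. d t * kernel_comb K c t)"
    using fin by (intro sum.cong refl)
      (simp add: kernel_comb_superset[of ?A c] sum_distrib_left mult_ac)
  also have "\<dots> = (\<Sum>t | d t \<noteq> 0. d t * kernel_comb K c t)"
    using fin by (intro sum.mono_neutral_right) auto
  finally show ?thesis .
qed

lemma kernel_form_commute:
  assumes "c \<in> coeffs_on T" "d \<in> coeffs_on T" "psd_kernel K"
  shows "kernel_form K c d = kernel_form K d c"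
proof -
  have "kernel_form K d c = (\<Sum>s | c s \<noteq> 0. \<Sum>t | d t \<noteq> 0. d t * c s * K t s)"
    unfolding kernel_form_def by (rule sum.swap)
  also have "\<dots> = kernel_form K c d"
    using assms(3) by (auto simp: kernel_form_def psd_kernel_def mult_ac intro!: sum.cong)
  finally show ?thesis by simp
qed

lemma coeffs_on_diff:
  assumes "c \<in> coeffs_on T" "d \<in> coeffs_on T"
  shows "(\<lambda>s. c s - d s) \<in> coeffs_on T"
proof -
  have "{s. c s - d s \<noteq> 0} \<subseteq> {s. c s \<noteq> 0} \<union> {s. d s \<noteq> 0}" by auto
  with assms show ?thesis
    by (auto simp: coeffs_on_def intro: finite_subset)
qed

lemma kernel_comb_diff:
  assumes "c \<in> coeffs_on T" "d \<in> coeffs_on T"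
  shows "kernel_comb K (\<lambda>s. c s - d s) x = kernel_comb K c x - kernel_comb K d x"
proof -
  let ?A = "{s. c s \<noteq> 0} \<union> {s. d s \<noteq> 0}"
  have fin: "finite ?A" using assms by (auto simp: coeffs_on_def)
  have ex: "kernel_comb K e x = (\<Sum>s\<in>?A. e s * K s x)" if "{s. e s \<noteq> 0} \<subseteq> ?A" for e
    using fin that by (rule kernel_comb_superset)
  show ?thesis
    by (subst (1 2 3) ex) (auto simp: sum_subtractf[symmetric] left_diff_distrib)
qed

lemma kernel_form_diff:
  assumes cd: "c \<in> coeffs_on T" "d \<in> coeffs_on T" and psd: "psd_kernel K"
  shows "kernel_form K (\<lambda>s. c s - d s) (\<lambda>s. c s - d s)
           = kernel_form K c c - 2 * kernel_form K c d + kernel_form K d d"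
proof -
  let ?A = "{s. c s \<noteq> 0} \<union> {s. d s \<noteq> 0}"
  have fin: "finite ?A" using cd by (auto simp: coeffs_on_def)
  have ex: "kernel_form K e f = (\<Sum>s\<in>?A. \<Sum>t\<in>?A. e s * f t * K s t)"
    if "{s. e s \<noteq> 0} \<subseteq> ?A" "{s. f s \<noteq> 0} \<subseteq> ?A" for e f
    using fin that by (rule kernel_form_superset)
  have "kernel_form K (\<lambda>s. c s - d s) (\<lambda>s. c s - d s)
          = kernel_form K c c - kernel_form K c d - kernel_form K d c + kernel_form K d d"
    by (subst (1 2 3 4 5) ex)
      (auto simp: sum_subtractf[symmetric] sum.distrib[symmetric] algebra_simps)
  with kernel_form_commute[OF cd psd] show ?thesis by simp
qed

lemma kernel_form_tendsto_zero:
  assumes coeffs: "\<And>n. e n \<in> coeffs_on T" and d: "d \<in> coeffs_on T"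
    and null: "\<And>x. x \<in> T \<Longrightarrow> (\<lambda>n. kernel_comb K (e n) x) \<longlonglongrightarrow> 0"
  shows "(\<lambda>n. kernel_form K (e n) d) \<longlonglongrightarrow> 0"
proof -
  have "(\<lambda>n. \<Sum>s | d s \<noteq> 0. d s * kernel_comb K (e n) s) \<longlonglongrightarrow> (\<Sum>s | d s \<noteq> 0. d s * 0)"
    using d by (intro tendsto_sum tendsto_mult tendsto_const null) (auto simp: coeffs_on_def)
  then show ?thesis
    by (simp add: kernel_form_eq_comb[OF coeffs d])
qed

text \<open>
  Write \<open>B\<close> for \<open>kernel_form K\<close> and \<open>Q(c) = B(c, c)\<close>. Expanding
  \<open>Q(e n - e N) = Q(e n) - 2 B(e n, e N) + Q(e N)\<close> with \<open>Q(e N) \<ge> 0\<close> bounds \<open>Q(e n)\<close>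
  by the small number \<open>Q(e n - e N)\<close> plus \<open>2 B(e n, e N)\<close>; for fixed \<open>N\<close> the latter tends to 0 by
  the reproducing property.
\<close>

lemma kernel_norm_tendsto_zero:
  assumes psd: "psd_kernel K"
    and coeffs: "\<And>n. e n \<in> coeffs_on T"
    and cauchy: "\<And>\<epsilon>. \<epsilon> > 0 \<Longrightarrow> \<exists>N. \<forall>m\<ge>N. \<forall>n\<ge>N. kernel_comb_norm K (\<lambda>s. e m s - e n s) < \<epsilon>"
    and null: "\<And>x. x \<in> T \<Longrightarrow> (\<lambda>n. kernel_comb K (e n) x) \<longlonglongrightarrow> 0"
  shows "(\<lambda>n. kernel_form K (e n) (e n)) \<longlonglongrightarrow> 0"
proof (rule LIMSEQ_I)
  fix r :: real assume r: "0 < r"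
  have weak: "(\<lambda>n. kernel_form K (e n) d) \<longlonglongrightarrow> 0" if "d \<in> coeffs_on T" for d
    by (rule kernel_form_tendsto_zero[OF coeffs that null])
  obtain N where N: "\<And>m n. m \<ge> N \<Longrightarrow> n \<ge> N \<Longrightarrow> kernel_comb_norm K (\<lambda>s. e m s - e n s) < sqrt (r / 2)"
    using cauchy[of "sqrt (r / 2)"] r by auto
  obtain N' where N': "\<And>n. n \<ge> N' \<Longrightarrow> \<bar>kernel_form K (e n) (e N)\<bar> < r / 4"
    using LIMSEQ_D[OF weak[OF coeffs[of N]], of "r / 4"] r by auto
  show "\<exists>no. \<forall>n\<ge>no. norm (kernel_form K (e n) (e n) - 0) < r"
  proof (intro exI allI impI)
    fix n assume n: "n \<ge> max N N'"
    have "kernel_form K (\<lambda>s. e n s - e N s) (\<lambda>s. e n s - e N s) < r / 2"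
      using N[of n N] n by (simp add: kernel_comb_norm_eq)
    then have "kernel_form K (e n) (e n) < r"
      using kernel_form_diff[OF coeffs[of n] coeffs[of N] psd] N'[of n] n
        kernel_form_nonneg[OF psd coeffs[of N]] by simp
    then show "norm (kernel_form K (e n) (e n) - 0) < r"
      using kernel_form_nonneg[OF psd coeffs[of n]] by simp
  qed
qed

lemma kernel_comb_in_rkhs:
  assumes "c \<in> coeffs_on T"
  shows "rkhs_approx K T (\<lambda>n. c) (kernel_comb K c)" "kernel_comb K c \<in> rkhs K T"
proof -
  show "rkhs_approx K T (\<lambda>n. c) (kernel_comb K c)"
    using assms by (auto simp: rkhs_approx_def kernel_comb_norm_def)
  then show "kernel_comb K c \<in> rkhs K T" by (auto simp: rkhs_def)
qed

text \<open>
  The constant sequence already exhibits the norm of a finite combination as a limit. The content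
  is uniqueness: for any other approximating sequence \<open>c'\<close> the differences \<open>c' n - c\<close> are Cauchy
  and pointwise null, hence null in norm.
\<close>

lemma rkhs_norm_kernel_comb:
  assumes psd: "psd_kernel K" and c: "c \<in> coeffs_on T"
  shows "rkhs_norm K T (kernel_comb K c) = kernel_comb_norm K c"
  unfolding rkhs_norm_def
proof (rule the_equality)
  show "\<exists>c'. rkhs_approx K T c' (kernel_comb K c)
          \<and> (\<lambda>n. kernel_comb_norm K (c' n)) \<longlonglongrightarrow> kernel_comb_norm K c"
    using kernel_comb_in_rkhs(1)[OF c] by (intro exI[of _ "\<lambda>n. c"]) auto
next
  fix r assume "\<exists>c'. rkhs_approx K T c' (kernel_comb K c) \<and> (\<lambda>n. kernel_comb_norm K (c' n)) \<longlonglongrightarrow> r"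
  then obtain c' where appr: "rkhs_approx K T c' (kernel_comb K c)"
    and lim: "(\<lambda>n. kernel_comb_norm K (c' n)) \<longlonglongrightarrow> r" by blast
  define e where "e n s = c' n s - c s" for n s
  have c': "c' n \<in> coeffs_on T" for n using appr by (simp add: rkhs_approx_def)
  have e: "e n \<in> coeffs_on T" for n
    using coeffs_on_diff[OF c' c] by (simp add: e_def[abs_def])
  have null: "(\<lambda>n. kernel_comb K (e n) x) \<longlonglongrightarrow> 0" if "x \<in> T" for x
  proof -
    have "(\<lambda>n. kernel_comb K (c' n) x - kernel_comb K c x) \<longlonglongrightarrow> kernel_comb K c x - kernel_comb K c x"
      using appr that by (intro tendsto_diff tendsto_const) (auto simp: rkhs_approx_def)
    then show ?thesis
      by (simp add: e_def[abs_def] kernel_comb_diff[OF c' c])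
  qed
  have "(\<lambda>n. kernel_form K (e n) (e n)) \<longlonglongrightarrow> 0"
    using appr by (intro kernel_norm_tendsto_zero[OF psd e _ null]) (auto simp: rkhs_approx_def e_def)
  moreover have "(\<lambda>n. kernel_form K (e n) c) \<longlonglongrightarrow> 0"
    by (rule kernel_form_tendsto_zero[OF e c null])
  moreover have "kernel_form K (c' n) (c' n)
      = kernel_form K (e n) (e n) + 2 * kernel_form K (e n) c + kernel_form K c c" for n
  proof -
    \<comment> \<open>The sum \<open>c' n = e n + c\<close> is expanded as the difference of \<open>e n\<close> and \<open>- c\<close>.\<close>
    have "(\<lambda>s. e n s - (- c s)) = c' n" by (auto simp: e_def)
    moreover have "(\<lambda>s. - c s) \<in> coeffs_on T" using c by (auto simp: coeffs_on_def)
    moreover have "kernel_form K (e n) (\<lambda>s. - c s) = - kernel_form K (e n) c"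
      "kernel_form K (\<lambda>s. - c s) (\<lambda>s. - c s) = kernel_form K c c"
      by (auto simp: kernel_form_def sum_negf)
    ultimately show ?thesis
      using kernel_form_diff[OF e[of n] _ psd, of "\<lambda>s. - c s"] by simp
  qed
  ultimately have "(\<lambda>n. kernel_form K (c' n) (c' n)) \<longlonglongrightarrow> 0 + 2 * 0 + kernel_form K c c"
    by (simp only:) (intro tendsto_intros)
  then have "(\<lambda>n. kernel_comb_norm K (c' n)) \<longlonglongrightarrow> kernel_comb_norm K c"
    unfolding kernel_comb_norm_eq by (intro tendsto_real_sqrt) simp
  with lim show "r = kernel_comb_norm K c" by (rule LIMSEQ_unique)
qed

section \<open>Positive semidefiniteness of the squared exponential periodic kernel\<close>

text \<open>
  By the addition theorem \<open>cos (s - t)\<close> is a sum of two products \<open>f s * f t\<close>; the binomial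
  expansion of its \<open>n\<close>-th power is again a positive combination of such products, and each of them
  contributes a square.
\<close>

lemma psd_cos_power:
  fixes A :: "real set"
  shows "0 \<le> (\<Sum>s\<in>A. \<Sum>t\<in>A. c s * c t * cos (s - t) ^ n)"
proof -
  have "(\<Sum>s\<in>A. \<Sum>t\<in>A. c s * c t * cos (s - t) ^ n)
      = (\<Sum>s\<in>A. \<Sum>t\<in>A. \<Sum>j\<le>n. of_nat (n choose j) *
            ((c s * cos s ^ j * sin s ^ (n - j)) * (c t * cos t ^ j * sin t ^ (n - j))))"
    by (simp add: cos_diff binomial_ring sum_distrib_left power_mult_distrib mult_ac)
  also have "\<dots> = (\<Sum>s\<in>A. \<Sum>j\<le>n. \<Sum>t\<in>A. of_nat (n choose j) *
            ((c s * cos s ^ j * sin s ^ (n - j)) * (c t * cos t ^ j * sin t ^ (n - j))))"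
    by (intro sum.cong refl sum.swap)
  also have "\<dots> = (\<Sum>j\<le>n. \<Sum>s\<in>A. \<Sum>t\<in>A. of_nat (n choose j) *
            ((c s * cos s ^ j * sin s ^ (n - j)) * (c t * cos t ^ j * sin t ^ (n - j))))"
    by (rule sum.swap)
  also have "\<dots> = (\<Sum>j\<le>n. of_nat (n choose j) * (\<Sum>s\<in>A. c s * cos s ^ j * sin s ^ (n - j))\<^sup>2)"
    unfolding power2_eq_square sum_product by (simp only: sum_distrib_left)
  also have "\<dots> \<ge> 0" by (intro sum_nonneg) auto
  finally show ?thesis .
qed

lemma psd_exp_cos:
  fixes A :: "real set"
  assumes "finite A" "r \<ge> 0"
  shows "0 \<le> (\<Sum>s\<in>A. \<Sum>t\<in>A. c s * c t * exp (r * cos (s - t)))"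
proof -
  have "(\<lambda>n. \<Sum>s\<in>A. \<Sum>t\<in>A. c s * c t * ((r * cos (s - t)) ^ n /\<^sub>R fact n))
          sums (\<Sum>s\<in>A. \<Sum>t\<in>A. c s * c t * exp (r * cos (s - t)))"
    by (intro sums_sum sums_mult exp_converges)
  moreover have "0 \<le> (\<Sum>s\<in>A. \<Sum>t\<in>A. c s * c t * ((r * cos (s - t)) ^ n /\<^sub>R fact n))" for n
  proof -
    have "(\<Sum>s\<in>A. \<Sum>t\<in>A. c s * c t * ((r * cos (s - t)) ^ n /\<^sub>R fact n))
       = r ^ n / fact n * (\<Sum>s\<in>A. \<Sum>t\<in>A. c s * c t * cos (s - t) ^ n)"
      by (simp add: sum_distrib_left power_mult_distrib field_simps)
    then show ?thesis using psd_cos_power[of c n A] assms by simp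
  qed
  ultimately show ?thesis
    by (rule sums_le[OF _ sums_zero, rotated])
qed

lemma sep_kernel_eq_exp_cos:
  "sep_kernel a s t = exp (- 2 * a\<^sup>2) * exp (2 * a\<^sup>2 * cos (2 * pi * s - 2 * pi * t))"
proof -
  have "cos (2 * pi * s - 2 * pi * t) = 1 - 2 * (sin (pi * s - pi * t))\<^sup>2"
    using cos_double_sin[of "pi * s - pi * t"] by (simp add: algebra_simps)
  then show ?thesis
    by (simp only: sep_kernel_def exp_add[symmetric]) (simp add: algebra_simps)
qed

text \<open>
  Up to the factor \<open>exp (- 2 * a\<^sup>2)\<close> the kernel is the exponential of a nonnegative multiple of a
  cosine, so that the exponential series expresses it by powers of the cosine with nonnegative
  coefficients.
\<close>

lemma psd_sep_kernel: "psd_kernel (sep_kernel a)"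
  unfolding psd_kernel_def
proof (intro conjI allI impI)
  show "sep_kernel a s t = sep_kernel a t s" for s t
    unfolding sep_kernel_def using sin_minus[of "pi * s - pi * t"] by simp
next
  fix A :: "real set" and c :: "real \<Rightarrow> real" assume A: "finite A"
  let ?B = "(\<lambda>s. 2 * pi * s) ` A"
  let ?c = "\<lambda>u. c (u / (2 * pi))"
  have "(\<Sum>s\<in>A. \<Sum>t\<in>A. c s * c t * sep_kernel a s t)
    = exp (- 2 * a\<^sup>2) * (\<Sum>u\<in>?B. \<Sum>v\<in>?B. ?c u * ?c v * exp (2 * a\<^sup>2 * cos (u - v)))"
    by (simp add: sep_kernel_eq_exp_cos sum.reindex inj_on_def sum_distrib_left mult_ac)
  also have "\<dots> \<ge> 0"
    using A by (intro mult_nonneg_nonneg psd_exp_cos) auto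
  finally show "0 \<le> (\<Sum>s\<in>A. \<Sum>t\<in>A. c s * c t * sep_kernel a s t)" .
qed

section \<open>Averaging operators on the circle\<close>

lemma integral_period_shift:
  fixes f :: "real \<Rightarrow> real"
  assumes cont: "continuous_on UNIV f" and per: "\<And>x. f (x + 1) = f x" and b: "0 \<le> b" "b \<le> 1"
  shows "integral {- b..1 - b} f = integral {0..1} f"
proof -
  have int: "f integrable_on {c..d}" for c d
    using cont by (intro integrable_continuous_interval) (rule continuous_on_subset, auto)
  have "integral {- b..0} f = integral {1 - b..1} f"
    using integral_shift_real_ivl[of "1 - b" 1 1 f] by (simp add: per)
  moreover have "integral {- b..0} f + integral {0..1 - b} f = integral {- b..1 - b} f"
    using b int by (intro Henstock_Kurzweil_Integration.integral_combine) auto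
  moreover have "integral {0..1 - b} f + integral {1 - b..1} f = integral {0..1} f"
    using b int by (intro Henstock_Kurzweil_Integration.integral_combine) auto
  ultimately show ?thesis by simp
qed

text \<open>
  Going back by \<open>u\<close> is, for a 1-periodic function, the same as going forward by \<open>1 - u\<close>. So the
  increments over \<open>u\<close> in the unit interval are controlled by \<open>min u (1 - u)\<close>, the distance of
  \<open>u\<close> to 0 on the circle.
\<close>

lemma periodic_modulus_wrap:
  fixes f :: "real \<Rightarrow> real"
  assumes per: "\<And>x. f (x + 1) = f x"
    and mod: "\<And>x d. 0 \<le> d \<Longrightarrow> d \<le> 1 \<Longrightarrow> \<bar>f x - f (x - d)\<bar> \<le> \<omega> d"
    and u: "0 \<le> u" "u \<le> 1"
  shows "\<bar>f x - f (x - u)\<bar> \<le> \<omega> (min u (1 - u))"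
proof (cases "u \<le> 1 - u")
  case True
  with mod[of u x] u show ?thesis by (simp add: min_def)
next
  case False
  have "f (x - u) = f (x + (1 - u))"
    using per[of "x - u"] by (simp add: algebra_simps)
  with mod[of "1 - u" "x + (1 - u)"] u False show ?thesis
    by (simp add: min_def abs_minus_commute)
qed

text \<open>
  A probability density on the circle, given by its values on one period.
\<close>

locale averaging_kernel =
  fixes \<kappa> :: "real \<Rightarrow> real"
  assumes cont: "continuous_on {0..1} \<kappa>"
    and nonneg: "\<And>u. u \<in> {0..1} \<Longrightarrow> 0 \<le> \<kappa> u"
    and mass: "integral {0..1} \<kappa> = 1"
begin

definition avg :: "(real \<Rightarrow> real) \<Rightarrow> real \<Rightarrow> real" where
  "avg f x = integral {0..1} (\<lambda>u. \<kappa> u * f (x - u))"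

definition residual :: "(real \<Rightarrow> real) \<Rightarrow> real \<Rightarrow> real" where
  "residual f x = f x - avg f x"

lemma integrable_kernel_mult:
  assumes "continuous_on {0..1} g"
  shows "(\<lambda>u. \<kappa> u * g u) integrable_on {0..1}"
  using cont assms by (intro integrable_continuous_interval continuous_on_mult)

lemma continuous_reflected:
  assumes "continuous_on UNIV (f :: real \<Rightarrow> real)"
  shows "continuous_on S (\<lambda>u. f (x - u))"
  by (rule continuous_on_compose2[OF assms]) (auto intro!: continuous_intros)

lemma integral_kernel_mult_le:
  assumes "continuous_on {0..1} g" "continuous_on {0..1} h"
    and "\<And>u. u \<in> {0..1} \<Longrightarrow> \<bar>g u\<bar> \<le> h u"
  shows "\<bar>integral {0..1} (\<lambda>u. \<kappa> u * g u)\<bar> \<le> integral {0..1} (\<lambda>u. \<kappa> u * h u)"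
proof -
  have "norm (\<kappa> u * g u) \<le> \<kappa> u * h u" if "u \<in> {0..1}" for u
    using assms(3)[OF that] nonneg[OF that] by (auto simp: abs_mult intro: mult_left_mono)
  then show ?thesis
    using integral_norm_bound_integral[OF integrable_kernel_mult[OF assms(1)]
        integrable_kernel_mult[OF assms(2)]] by simp
qed

lemma avg_abs_le:
  assumes "continuous_on UNIV f" "\<And>x. \<bar>f x\<bar> \<le> M"
  shows "\<bar>avg f x\<bar> \<le> M"
proof -
  have "\<bar>avg f x\<bar> \<le> integral {0..1} (\<lambda>u. \<kappa> u * M)"
    unfolding avg_def using assms
    by (intro integral_kernel_mult_le continuous_reflected[OF assms(1)] continuous_on_const) auto
  then show ?thesis using mass by simp
qed

lemma residual_abs_le:
  assumes "continuous_on UNIV f" "\<And>x. \<bar>f x\<bar> \<le> M"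
  shows "\<bar>residual f x\<bar> \<le> 2 * M"
  using avg_abs_le[OF assms] assms(2)[of x] unfolding residual_def by (smt (verit))

text \<open>
  As \<open>\<kappa>\<close> has total mass 1, the residual at \<open>x\<close> is the \<open>\<kappa>\<close>-average of \<open>f x - f (x - u)\<close>.
\<close>

lemma residual_le_modulus:
  assumes f: "continuous_on UNIV f" and \<omega>: "continuous_on {0..1} \<omega>"
    and "\<And>u. u \<in> {0..1} \<Longrightarrow> \<bar>f x - f (x - u)\<bar> \<le> \<omega> u"
  shows "\<bar>residual f x\<bar> \<le> integral {0..1} (\<lambda>u. \<kappa> u * \<omega> u)"
proof -
  have "residual f x = integral {0..1} (\<lambda>u. \<kappa> u * f x) - avg f x"
    using mass by (simp add: residual_def)
  also have "\<dots> = integral {0..1} (\<lambda>u. \<kappa> u * (f x - f (x - u)))"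
    unfolding avg_def right_diff_distrib
    by (intro integral_diff[symmetric] integrable_kernel_mult continuous_on_const continuous_reflected[OF f])
  finally show ?thesis
    using assms by (auto intro!: integral_kernel_mult_le continuous_on_diff continuous_on_const continuous_reflected[OF f])
qed

lemma continuous_avg:
  assumes f: "continuous_on UNIV f"
  shows "continuous_on UNIV (avg f)"
proof -
  have "continuous_on UNIV (\<lambda>x. integral (cbox 0 1) (\<lambda>u. \<kappa> u * f (x - u)))"
  proof (intro integral_continuous_on_param)
    show "continuous_on (UNIV \<times> cbox 0 1) (\<lambda>(x, u). \<kappa> u * f (x - u))"
      unfolding split_beta
      by (intro continuous_on_mult continuous_on_compose2[OF cont] continuous_on_compose2[OF f])
        (auto intro!: continuous_intros)
  qed
  then show ?thesis by (simp add: avg_def[abs_def])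
qed

lemma avg_has_derivative:
  assumes f: "\<And>x. (f has_real_derivative f' x) (at x)" and f': "continuous_on UNIV f'"
  shows "(avg f has_real_derivative avg f' x) (at x)"
proof -
  have cf: "continuous_on UNIV f"
    using f by (intro DERIV_continuous_on) (auto intro: has_field_derivative_at_within)
  have "((\<lambda>x. integral (cbox 0 1) (\<lambda>u. \<kappa> u * f (x - u))) has_real_derivative
          integral (cbox 0 1) (\<lambda>u. \<kappa> u * f' (x - u))) (at x within UNIV)"
  proof (rule leibniz_rule_field_derivative)
    show "((\<lambda>x. \<kappa> u * f (x - u)) has_real_derivative \<kappa> u * f' (x - u)) (at x within UNIV)" for x u
      by (auto intro!: derivative_eq_intros DERIV_chain2[OF f])
    show "(\<lambda>u. \<kappa> u * f (x - u)) integrable_on cbox 0 1" for x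
      using integrable_kernel_mult[OF continuous_reflected[OF cf]] by simp
    show "continuous_on (UNIV \<times> cbox 0 1) (\<lambda>(x, u). \<kappa> u * f' (x - u))"
      unfolding split_beta
      by (intro continuous_on_mult continuous_on_compose2[OF cont] continuous_on_compose2[OF f'])
        (auto intro!: continuous_intros)
  qed auto
  then show ?thesis by (simp add: avg_def[abs_def])
qed

lemma residual_power_Suc:
  "(residual ^^ Suc n) f x = (residual ^^ n) f x - avg ((residual ^^ n) f) x"
  by (simp add: residual_def)

lemma continuous_residual_power:
  "continuous_on UNIV f \<Longrightarrow> continuous_on UNIV ((residual ^^ n) f)"
  by (induction n)
    (auto simp: residual_def[abs_def] intro!: continuous_intros continuous_avg)

lemma periodic_residual_power:
  assumes "\<And>x. f (x + 1) = f x"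
  shows "(residual ^^ n) f (x + 1) = (residual ^^ n) f x"
proof (induction n arbitrary: x)
  case (Suc n)
  have "(residual ^^ n) f (x + 1 - u) = (residual ^^ n) f (x - u)" for u
    using Suc.IH[of "x - u"] by (simp add: algebra_simps)
  then show ?case
    unfolding residual_power_Suc by (simp add: avg_def Suc.IH)
qed (simp add: assms)

lemma residual_power_has_derivative:
  assumes "\<And>x. (f has_real_derivative f' x) (at x)" "continuous_on UNIV f'"
  shows "((residual ^^ n) f has_real_derivative (residual ^^ n) f' x) (at x)"
proof (induction n arbitrary: x)
  case (Suc n)
  have "((\<lambda>x. (residual ^^ n) f x - avg ((residual ^^ n) f) x) has_real_derivative
          (residual ^^ n) f' x - avg ((residual ^^ n) f') x) (at x)"
    by (intro DERIV_diff Suc.IH avg_has_derivative continuous_residual_power assms)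
  then show ?case unfolding residual_power_Suc[abs_def] .
qed (simp add: assms)

text \<open>
  Each power of the residual operator gains a factor \<open>A\<close>, a bound for the first absolute moment
  of the kernel, as long as a derivative is left: the residual of \<open>f\<close> is at most \<open>A\<close> times the supremum of
  \<open>\<bar>f'\<bar>\<close>, and forming residuals commutes with differentiation. Applied to
  \<open>f = (residual ^^ Suc n) (F 0)\<close>, whose derivative \<open>(residual ^^ Suc n) (F 1)\<close> is bounded by the
  induction hypothesis for the shifted sequence, this is the induction step.
\<close>

lemma residual_power_le:
  assumes moment: "integral {0..1} (\<lambda>u. \<kappa> u * min u (1 - u)) \<le> A"
    and deriv: "\<And>k x. k < n \<Longrightarrow> (F k has_real_derivative F (Suc k) x) (at x)"
    and per: "\<And>k x. F k (x + 1) = F k x"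
    and last: "continuous_on UNIV (F n)" "\<And>x. \<bar>residual (F n) x\<bar> \<le> B"
  shows "\<bar>(residual ^^ Suc n) (F 0) x\<bar> \<le> A ^ n * B"
  using deriv per last
proof (induction n arbitrary: F x)
  case (Suc n)
  have B0: "0 \<le> B" using Suc.prems(4)[of 0] by linarith
  have "0 \<le> integral {0..1} (\<lambda>u. \<kappa> u * min u (1 - u))"
    using nonneg by (intro integral_nonneg integrable_kernel_mult continuous_intros) auto
  then have A0: "0 \<le> A" using moment by linarith
  define f where "f = (residual ^^ Suc n) (F 0)"
  define f' where "f' = (residual ^^ Suc n) (F 1)"
  have cF: "continuous_on UNIV (F 1)"
  proof (cases n)
    case 0 then show ?thesis using Suc.prems(3) by simp
  next
    case (Suc m)
    then show ?thesis using Suc.prems(1)[of 1]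
      by (intro DERIV_continuous_on[of _ _ "F 2"]) (auto intro: has_field_derivative_at_within simp: numeral_2_eq_2)
  qed
  have f'_le: "\<bar>f' x\<bar> \<le> A ^ n * B" for x
    using Suc.IH[of "\<lambda>k. F (Suc k)" x] Suc.prems by (simp add: f'_def)
  have der: "(f has_real_derivative f' x) (at x)" for x
    unfolding f_def f'_def using Suc.prems(1)[of 0] by (intro residual_power_has_derivative cF) simp
  have cf: "continuous_on UNIV f"
    using der by (intro DERIV_continuous_on) (auto intro: has_field_derivative_at_within)
  have lip: "\<bar>f x - f (x - d)\<bar> \<le> A ^ n * B * d" if "0 \<le> d" "d \<le> 1" for x d
  proof (cases "d = 0")
    case False
    then have "x - d < x" using that by simp
    then have "\<exists>z. z > x - d \<and> z < x \<and> f x - f (x - d) = (x - (x - d)) * f' z"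
      by (rule MVT2) (rule der)
    then obtain z where z: "f x - f (x - d) = (x - (x - d)) * f' z"
      by blast
    have "\<bar>f x - f (x - d)\<bar> = \<bar>f' z\<bar> * d"
      unfolding z abs_mult using that by simp
    then show ?thesis
      using mult_right_mono[OF f'_le[of z] that(1)] by simp
  qed simp
  have fper: "f (x + 1) = f x" for x
    unfolding f_def by (intro periodic_residual_power Suc.prems(2))
  have cm: "continuous_on {0..1} (\<lambda>u::real. A ^ n * B * min u (1 - u))"
    by (intro continuous_intros)
  have "\<bar>residual f x\<bar> \<le> integral {0..1} (\<lambda>u. \<kappa> u * (A ^ n * B * min u (1 - u)))"
    using periodic_modulus_wrap[of f "\<lambda>d. A ^ n * B * d", OF fper lip]
    by (intro residual_le_modulus cf cm) auto
  also have "\<dots> = A ^ n * B * integral {0..1} (\<lambda>u. \<kappa> u * min u (1 - u))"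
    by (subst integral_mult_right[symmetric]) (simp add: mult_ac)
  also have "\<dots> \<le> A ^ n * B * A"
    using moment A0 B0 by (intro mult_left_mono) auto
  finally show ?case by (simp add: f_def mult_ac)
qed simp

lemma residual_power_abs_le:
  assumes "continuous_on UNIV f" "\<And>x. \<bar>f x\<bar> \<le> M"
  shows "\<bar>(residual ^^ n) f x\<bar> \<le> 2 ^ n * M"
proof (induction n arbitrary: x)
  case (Suc n)
  show ?case
    using residual_abs_le[OF continuous_residual_power[OF assms(1)] Suc.IH] by (simp add: mult_ac)
qed (simp add: assms)

text \<open>
  With \<open>T\<close> for the average this is the telescoping identity
  \<open>I - (I - T)\<^sup>n = T (\<Sum>j<n. (I - T)\<^sup>j)\<close>.
  It shows that the function left over after removing the small term \<open>(I - T)\<^sup>n f\<close> is the average of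
  a bounded function.
\<close>

lemma minus_residual_power:
  assumes f: "continuous_on UNIV f"
  shows "f x - (residual ^^ n) f x = avg (\<lambda>y. \<Sum>j<n. (residual ^^ j) f y) x"
proof (induction n)
  case (Suc n)
  let ?g = "\<lambda>y. \<Sum>j<n. (residual ^^ j) f y" and ?h = "(residual ^^ n) f"
  have "avg (\<lambda>y. ?g y + ?h y) x = avg ?g x + avg ?h x"
    unfolding avg_def distrib_left
    by (intro integral_add integrable_kernel_mult continuous_on_sum
        continuous_reflected[OF continuous_residual_power[OF f]])
  then show ?case using Suc.IH unfolding residual_power_Suc by simp
qed (simp add: avg_def)

text \<open>
  The first moment controls all lower fractional ones through
  \<open>(a * d) powr \<beta> \<le> 1 + a * d\<close>.
\<close>

lemma fractional_moment:
  assumes a: "a > 0" and \<beta>: "0 < \<beta>" "\<beta> \<le> 1"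
    and moment: "integral {0..1} (\<lambda>u. \<kappa> u * min u (1 - u)) \<le> C / a"
  shows "integral {0..1} (\<lambda>u. \<kappa> u * min u (1 - u) powr \<beta>) \<le> (1 + C) * a powr (- \<beta>)"
proof -
  have pointwise: "d powr \<beta> \<le> a powr (- \<beta>) * (1 + a * d)" if d: "0 \<le> d" for d
  proof -
    have "(a * d) powr \<beta> \<le> 1 + a * d"
    proof (cases "a * d \<le> 1")
      case True
      then have "(a * d) powr \<beta> \<le> 1" using a d \<beta> by (intro powr_le1) auto
      then show ?thesis using a d by (smt (verit) mult_nonneg_nonneg)
    next
      case False
      then have "(a * d) powr \<beta> \<le> (a * d) powr 1" using \<beta> by (intro powr_mono) auto
      then show ?thesis using False by simp
    qed
    then have "a powr (- \<beta>) * (a * d) powr \<beta> \<le> a powr (- \<beta>) * (1 + a * d)"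
      by (intro mult_left_mono) auto
    moreover have "a powr (- \<beta>) * (a * d) powr \<beta> = d powr \<beta>"
      using a d by (simp add: powr_mult powr_minus field_simps)
    ultimately show ?thesis by simp
  qed
  have cm: "continuous_on {0..1} (\<lambda>u::real. min u (1 - u))" by (intro continuous_intros)
  have cp: "continuous_on {0..1} (\<lambda>u::real. min u (1 - u) powr \<beta>)"
    using \<beta> by (intro continuous_on_powr' cm continuous_on_const) auto
  have "integral {0..1} (\<lambda>u. \<kappa> u * min u (1 - u) powr \<beta>)
      \<le> integral {0..1} (\<lambda>u. \<kappa> u * (a powr (- \<beta>) * (1 + a * min u (1 - u))))"
    by (intro integral_le integrable_kernel_mult cp continuous_on_mult continuous_on_add
        continuous_on_const cm mult_left_mono pointwise nonneg) auto
  also have "\<dots> = integral {0..1} (\<lambda>u. a powr (- \<beta>) * (\<kappa> u + a * (\<kappa> u * min u (1 - u))))"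
    by (simp add: algebra_simps)
  also have "\<dots> = a powr (- \<beta>) * (1 + a * integral {0..1} (\<lambda>u. \<kappa> u * min u (1 - u)))"
    using integrable_continuous_interval[OF cont] integrable_kernel_mult[OF cm] mass
    by (simp add: integral_add integrable_on_mult_right)
  also have "\<dots> \<le> a powr (- \<beta>) * (1 + C)"
    using mult_left_mono[OF moment, of a] a by (intro mult_left_mono add_left_mono) auto
  finally show ?thesis by (simp add: mult.commute)
qed

end

section \<open>Periodic extension of functions with matching end points\<close>

lemma frac_in_unit: "frac (x :: real) \<in> {0..1}"
  using frac_ge_0[of x] frac_lt_1[of x] by (simp add: less_imp_le)

text \<open>
  Since \<open>f 0 = f 1\<close>, the formula for the periodic extension holds on the closed cell, in particular
  at its right end, where \<open>frac x = 0\<close>.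
\<close>

lemma frac_on_cell:
  fixes f :: "real \<Rightarrow> real"
  assumes "f 0 = f 1" "x \<in> {real_of_int n..real_of_int n + 1}"
  shows "f (frac x) = f (x - real_of_int n)"
proof (cases "x = real_of_int n + 1")
  case True
  then have "frac x = 0" by (simp add: frac_eq_0_iff)
  with True assms show ?thesis by simp
next
  case False
  then have "\<lfloor>x\<rfloor> = n" using assms(2) by (intro floor_unique) auto
  then show ?thesis by (simp add: frac_def)
qed

text \<open>
  Only the integers need care: there the one-sided derivatives come from the two ends of the unit
  interval, and they agree because \<open>f'\<close> takes the same value at both.
\<close>

lemma periodic_extension_has_derivative:
  fixes f f' :: "real \<Rightarrow> real"
  assumes der: "\<And>x. x \<in> {0..1} \<Longrightarrow> (f has_real_derivative f' x) (at x within {0..1})"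
    and match: "f 0 = f 1" "f' 0 = f' 1"
  shows "((\<lambda>x. f (frac x)) has_real_derivative f' (frac x)) (at x)"
proof -
  let ?I = "\<lambda>n. {real_of_int n..real_of_int n + 1}"
  have cell: "((\<lambda>x. f (frac x)) has_real_derivative f' (frac x)) (at x within ?I n)" if x: "x \<in> ?I n" for n
  proof -
    have "(f has_real_derivative f' (x - of_int n)) (at (x - of_int n) within (\<lambda>x. x - of_int n) ` ?I n)"
      using x by (intro has_field_derivative_subset[OF der]) auto
    then have "((\<lambda>x. f (x - of_int n)) has_real_derivative f' (x - of_int n) * 1) (at x within ?I n)"
      by (intro DERIV_image_chain[of f, unfolded o_def]) (auto intro!: derivative_eq_intros)
    then have "((\<lambda>x. f (x - of_int n)) has_real_derivative f' (frac x)) (at x within ?I n)"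
      using frac_on_cell[OF match(2) x] by simp
    then show ?thesis
      by (rule has_field_derivative_transform_within[OF _ zero_less_one x])
        (simp add: frac_on_cell[OF match(1)])
  qed
  obtain n where xn: "real_of_int n \<le> x" "x < real_of_int n + 1"
    by (rule that[of "\<lfloor>x\<rfloor>"]) linarith+
  show ?thesis
  proof (cases "x = of_int n")
    case False
    have "at x within ?I n = at x"
      using False xn by (intro at_within_interior) auto
    with cell[of n] xn show ?thesis by simp
  next
    case True
    have "((\<lambda>x. f (frac x)) has_real_derivative f' (frac x)) (at x within ?I (n - 1) \<union> ?I n)"
      using cell[of n] cell[of "n - 1"] True
      unfolding has_field_derivative_iff by (auto intro!: Lim_Un)
    moreover have "at x within ?I (n - 1) \<union> ?I n = at x"
    proof (rule at_within_open_subset)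
      show "x \<in> {x - 1<..<x + 1}" by simp
      show "{x - 1<..<x + 1} \<subseteq> ?I (n - 1) \<union> ?I n"
        using True by auto
    qed simp
    ultimately show ?thesis by simp
  qed
qed

text \<open>
  The factor 2 accounts for an interval that contains an integer: it is cut there, and each of the two
  parts is estimated in its own cell.
\<close>

lemma periodic_extension_hoelder:
  fixes f :: "real \<Rightarrow> real"
  assumes hoelder: "\<And>x y. x \<in> {0..1} \<Longrightarrow> y \<in> {0..1} \<Longrightarrow> \<bar>f x - f y\<bar> \<le> L * \<bar>x - y\<bar> powr \<beta>"
    and L: "L \<ge> 0" and \<beta>: "\<beta> > 0" and match: "f 0 = f 1" and d: "0 \<le> d" "d \<le> 1"
  shows "\<bar>f (frac x) - f (frac (x - d))\<bar> \<le> 2 * L * d powr \<beta>"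
proof -
  have cell: "\<bar>f (frac x) - f (frac y)\<bar> \<le> L * d powr \<beta>"
    if "x \<in> {of_int n..of_int n + 1}" "y \<in> {of_int n..of_int n + 1}" "\<bar>x - y\<bar> \<le> d" for x y n
  proof -
    have "\<bar>f (frac x) - f (frac y)\<bar> \<le> L * \<bar>x - y\<bar> powr \<beta>"
      using hoelder[of "x - of_int n" "y - of_int n"] that(1,2)
      by (simp add: frac_on_cell[OF match that(1)] frac_on_cell[OF match that(2)])
    also have "\<dots> \<le> L * d powr \<beta>"
      using that(3) L \<beta> by (intro mult_left_mono powr_mono2) auto
    finally show ?thesis .
  qed
  let ?n = "\<lfloor>x\<rfloor>"
  have xn: "real_of_int ?n \<le> x" "x < real_of_int ?n + 1" by linarith+
  have pos: "0 \<le> L * d powr \<beta>" using L by simp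
  show ?thesis
  proof (cases "of_int ?n \<le> x - d")
    case True
    then show ?thesis
      using cell[of x ?n "x - d"] xn d pos by auto
  next
    case False
    have "\<bar>f (frac x) - f (frac (of_int ?n))\<bar> \<le> L * d powr \<beta>"
      using xn False d by (intro cell[of _ ?n]) auto
    moreover have "\<bar>f (frac (of_int ?n)) - f (frac (x - d))\<bar> \<le> L * d powr \<beta>"
      using xn False d by (intro cell[of _ "?n - 1"]; simp; linarith)
    ultimately show ?thesis by linarith
  qed
qed

lemma continuous_of_backward_modulus:
  fixes f :: "real \<Rightarrow> real"
  assumes mod: "\<And>x d. 0 \<le> d \<Longrightarrow> d \<le> 1 \<Longrightarrow> \<bar>f x - f (x - d)\<bar> \<le> C * d powr \<beta>" and \<beta>: "\<beta> > 0"
  shows "continuous_on UNIV f"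
proof -
  have "(f \<longlongrightarrow> f x) (at x)" for x
  proof -
    have "((\<lambda>y. C * \<bar>y - x\<bar> powr \<beta>) \<longlongrightarrow> C * 0 powr \<beta>) (at x)"
      using \<beta> by (intro tendsto_mult tendsto_const tendsto_powr') (auto intro!: tendsto_eq_intros)
    then have lim: "((\<lambda>y. C * \<bar>y - x\<bar> powr \<beta>) \<longlongrightarrow> 0) (at x)" by simp
    have "norm (f y - f x) \<le> C * \<bar>y - x\<bar> powr \<beta>" if "dist y x < 1" for y
      using mod[of "y - x" y] mod[of "x - y" x] that
      by (cases "x \<le> y") (auto simp: dist_real_def abs_minus_commute)
    then have "\<forall>\<^sub>F y in at x. norm (f y - f x) \<le> C * \<bar>y - x\<bar> powr \<beta>"
      by (auto simp: eventually_at intro!: exI[of _ 1])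
    from Lim_null_comparison[OF this lim] show ?thesis
      by (subst Lim_null)
  qed
  then show ?thesis by (auto simp: continuous_on_def)
qed

section \<open>Mass and first moment of the squared exponential periodic kernel\<close>

lemma sep_kernel_translation: "sep_kernel a s t = sep_kernel a (s - t) 0"
  by (simp add: sep_kernel_def right_diff_distrib)

lemma sep_kernel_period: "sep_kernel a (u + 1) 0 = sep_kernel a u 0"
  by (simp add: sep_kernel_def distrib_left)

lemma sep_kernel_even: "sep_kernel a (- u) 0 = sep_kernel a u 0"
  by (simp add: sep_kernel_def)

text \<open>
  Jordan's inequality: on \<open>[0, 1/2]\<close> the concave function \<open>sin (pi * u)\<close> lies above its chord.
\<close>

lemma sin_pi_ge_double_dist:
  assumes "0 \<le> u" "u \<le> 1"
  shows "2 * min u (1 - u) \<le> sin (pi * u)"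
proof -
  have half: "2 * v \<le> sin (pi * v)" if v: "0 \<le> v" "v \<le> 1 / 2" for v :: real
  proof -
    have "concave_on {0..1/2} (\<lambda>v. sin (pi * v))"
    proof (rule f''_le0_imp_concave)
      show "((\<lambda>v. sin (pi * v)) has_real_derivative pi * cos (pi * v)) (at v)" for v
        by (auto intro!: derivative_eq_intros)
      show "((\<lambda>v. pi * cos (pi * v)) has_real_derivative - (pi * pi * sin (pi * v))) (at v)" for v
        by (auto intro!: derivative_eq_intros)
      show "- (pi * pi * sin (pi * v)) \<le> 0" if "v \<in> {0..1/2}" for v
      proof -
        have "pi * v \<le> pi * 1" using that by (intro mult_left_mono) auto
        then have "0 \<le> sin (pi * v)" using that by (intro sin_ge_zero) auto
        then show ?thesis by simp
      qed
    qed simp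
    from concave_onD[OF this, of "2 * v" 0 "1 / 2"] v show ?thesis by simp
  qed
  show ?thesis
  proof (cases "u \<le> 1 / 2")
    case True
    with half[of u] assms show ?thesis by (simp add: min_def)
  next
    case False
    have "sin (pi * (1 - u)) = sin (pi * u)"
      by (simp add: right_diff_distrib)
    with half[of "1 - u"] False assms show ?thesis by (simp add: min_def)
  qed
qed

text \<open>
  The integral of the kernel over the circle. It is of order \<open>1 / a\<close> for large \<open>a\<close>, because the kernel is
  concentrated at distances of order \<open>1 / a\<close> from the diagonal.
\<close>

definition sep_mass :: "real \<Rightarrow> real" where
  "sep_mass a = integral {0..1} (\<lambda>u. sep_kernel a u 0)"

lemma continuous_sep_kernel: "continuous_on S (\<lambda>u. sep_kernel a u 0)"
  unfolding sep_kernel_def by (intro continuous_intros)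

text \<open>
  The weights \<open>u\<close> and \<open>1 - u\<close> make the antiderivatives elementary.
\<close>

lemma has_integral_gauss_moment:
  fixes c :: real
  assumes "c > 0"
  shows "((\<lambda>u. u * exp (- c * u\<^sup>2)) has_integral (1 - exp (- c)) / (2 * c)) {0..1}"
    and "((\<lambda>u. (1 - u) * exp (- c * (1 - u)\<^sup>2)) has_integral (1 - exp (- c)) / (2 * c)) {0..1}"
proof -
  let ?P = "\<lambda>u :: real. exp (- c * u\<^sup>2) / (2 * c)"
  have P: "(?P has_real_derivative - (u * exp (- c * u\<^sup>2))) (at u)" for u
    using assms by (auto intro!: derivative_eq_intros)
  have 1: "((\<lambda>u. - ?P u) has_real_derivative u * exp (- c * u\<^sup>2)) (at u)" for u
    using DERIV_minus[OF P[of u]] by simp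
  have 2: "((\<lambda>u. ?P (1 - u)) has_real_derivative (1 - u) * exp (- c * (1 - u)\<^sup>2)) (at u)" for u
    by (rule DERIV_cong[OF DERIV_chain2[OF P, of "\<lambda>u. 1 - u" "- 1"]])
      (auto intro!: derivative_eq_intros)
  have "((\<lambda>u. u * exp (- c * u\<^sup>2)) has_integral - ?P 1 - (- ?P 0)) {0..1}"
    by (intro fundamental_theorem_of_calculus has_field_derivative_at_within[OF 1,
          unfolded has_real_derivative_iff_has_vector_derivative]) simp
  then show "((\<lambda>u. u * exp (- c * u\<^sup>2)) has_integral (1 - exp (- c)) / (2 * c)) {0..1}"
    by (simp add: diff_divide_distrib)
  have "((\<lambda>u. (1 - u) * exp (- c * (1 - u)\<^sup>2)) has_integral ?P (1 - 1) - ?P (1 - 0)) {0..1}"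
    by (intro fundamental_theorem_of_calculus has_field_derivative_at_within[OF 2,
          unfolded has_real_derivative_iff_has_vector_derivative]) simp
  then show "((\<lambda>u. (1 - u) * exp (- c * (1 - u)\<^sup>2)) has_integral (1 - exp (- c)) / (2 * c)) {0..1}"
    by (simp add: diff_divide_distrib)
qed

text \<open>
  Jordan's inequality bounds the kernel by a Gaussian in the distance \<open>min u (1 - u)\<close> to the
  nearest end point; the integral is then bounded by the sum of the contributions of both end
  points, each over the whole interval.
\<close>

lemma sep_kernel_moment:
  assumes a: "a > 0"
  shows "integral {0..1} (\<lambda>u. sep_kernel a u 0 * min u (1 - u)) \<le> 1 / (16 * a\<^sup>2)"
proof -
  let ?G = "\<lambda>u. exp (- (16 * a\<^sup>2) * u\<^sup>2)"
  have c: "16 * a\<^sup>2 > 0" using a by simp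
  have "sep_kernel a u 0 * min u (1 - u) \<le> u * ?G u + (1 - u) * ?G (1 - u)" if u: "u \<in> {0..1}" for u
  proof -
    let ?m = "min u (1 - u)"
    have m: "0 \<le> ?m" using u by auto
    have "(2 * ?m)\<^sup>2 \<le> (sin (pi * u))\<^sup>2"
      using sin_pi_ge_double_dist[of u] u m by (intro power_mono) auto
    then have "4 * a\<^sup>2 * (4 * ?m\<^sup>2) \<le> 4 * a\<^sup>2 * (sin (pi * u))\<^sup>2"
      by (intro mult_left_mono) (auto simp: power_mult_distrib)
    then have "sep_kernel a u 0 \<le> ?G ?m"
      by (simp add: sep_kernel_def)
    then have "sep_kernel a u 0 * ?m \<le> ?m * ?G ?m"
      using mult_left_mono[OF _ m] by (simp only: mult.commute[of _ ?m])
    also have "\<dots> \<le> u * ?G u + (1 - u) * ?G (1 - u)"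
      using u by (auto simp: min_def)
    finally show ?thesis .
  qed
  then have "integral {0..1} (\<lambda>u. sep_kernel a u 0 * min u (1 - u))
      \<le> (1 - exp (- (16 * a\<^sup>2))) / (2 * (16 * a\<^sup>2)) + (1 - exp (- (16 * a\<^sup>2))) / (2 * (16 * a\<^sup>2))"
    by (intro has_integral_le[OF integrable_integral has_integral_add[OF has_integral_gauss_moment[OF c]]]
        integrable_continuous_interval continuous_on_mult continuous_sep_kernel continuous_on_min
        continuous_on_diff continuous_on_const continuous_on_id)
  also have "\<dots> \<le> 1 / (16 * a\<^sup>2)"
    using a by (simp add: field_simps)
  finally show ?thesis .
qed

text \<open>
  On \<open>[0, 1 / (2 * a)]\<close> the exponent of the kernel is at least \<open>- pi\<^sup>2\<close>.
\<close>

lemma sep_mass_ge: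
  assumes a: "a \<ge> 1"
  shows "exp (- pi\<^sup>2) / (2 * a) \<le> sep_mass a"
proof -
  have int: "(\<lambda>u. sep_kernel a u 0) integrable_on {c..d}" for c d
    by (intro integrable_continuous_interval continuous_sep_kernel)
  have "exp (- pi\<^sup>2) / (2 * a) = integral {0..1 / (2 * a)} (\<lambda>u. exp (- pi\<^sup>2))"
    using a by simp
  also have "\<dots> \<le> integral {0..1 / (2 * a)} (\<lambda>u. sep_kernel a u 0)"
  proof (intro integral_le int)
    fix u assume u: "u \<in> {0..1 / (2 * a)}"
    have "\<bar>sin (pi * u)\<bar> \<le> \<bar>pi * u\<bar>" by (rule abs_sin_x_le_abs_x)
    also have "\<dots> \<le> pi / (2 * a)"
      using u a mult_left_mono[of u "1 / (2 * a)" pi] by (simp add: abs_mult)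
    finally have "\<bar>sin (pi * u)\<bar>\<^sup>2 \<le> (pi / (2 * a))\<^sup>2"
      by (intro power_mono) auto
    then have "4 * a\<^sup>2 * (sin (pi * u))\<^sup>2 \<le> 4 * a\<^sup>2 * (pi / (2 * a))\<^sup>2"
      by (intro mult_left_mono) auto
    also have "\<dots> = pi\<^sup>2" using a by (simp add: power_divide power_mult_distrib)
    finally show "exp (- pi\<^sup>2) \<le> sep_kernel a u 0"
      by (simp add: sep_kernel_def)
  qed auto
  also have "\<dots> \<le> integral {0..1} (\<lambda>u. sep_kernel a u 0)"
    using a by (intro integral_subset_le int) (auto simp: sep_kernel_def)
  finally show ?thesis by (simp add: sep_mass_def)
qed

lemma averaging_sep_kernel:
  assumes "a \<ge> 1"
  shows "averaging_kernel (\<lambda>u. sep_kernel a u 0 / sep_mass a)"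
    and "integral {0..1} (\<lambda>u. sep_kernel a u 0 / sep_mass a * min u (1 - u)) \<le> exp (pi\<^sup>2) / a"
    and "sep_mass a > 0"
proof -
  have "0 < exp (- pi\<^sup>2) / (2 * a)" using assms by simp
  then show Z: "sep_mass a > 0"
    using sep_mass_ge[OF assms] by linarith
  show "averaging_kernel (\<lambda>u. sep_kernel a u 0 / sep_mass a)"
  proof
    show "continuous_on {0..1} (\<lambda>u. sep_kernel a u 0 / sep_mass a)"
      using Z by (intro continuous_on_divide continuous_sep_kernel continuous_on_const) auto
  qed (use Z in \<open>auto simp: sep_kernel_def[of a _ 0] sep_mass_def\<close>)
  have "integral {0..1} (\<lambda>u. sep_kernel a u 0 / sep_mass a * min u (1 - u))
      = integral {0..1} (\<lambda>u. sep_kernel a u 0 * min u (1 - u)) / sep_mass a"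
    by (simp flip: integral_divide)
  also have "\<dots> \<le> 1 / (16 * a\<^sup>2) / (exp (- pi\<^sup>2) / (2 * a))"
    using assms by (intro frac_le sep_kernel_moment sep_mass_ge) auto
  also have "\<dots> = exp (pi\<^sup>2) / (8 * a)"
    using assms by (simp add: exp_minus field_simps power2_eq_square)
  also have "\<dots> \<le> exp (pi\<^sup>2) / a"
    using assms by (intro divide_left_mono) auto
  finally show "integral {0..1} (\<lambda>u. sep_kernel a u 0 / sep_mass a * min u (1 - u)) \<le> exp (pi\<^sup>2) / a" .
qed

section \<open>Riemann sums of convolutions as elements of the Hilbert space\<close>

text \<open>
  Uniform continuity on the square makes the speed of convergence independent of the parameter.
\<close>

lemma riemann_sum_uniform:
  fixes F :: "real \<Rightarrow> real \<Rightarrow> real"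
  assumes cont: "continuous_on ({0..1} \<times> {0..1}) (\<lambda>(x, t). F x t)" and e: "e > 0"
  shows "\<forall>\<^sub>F N in sequentially. \<forall>x\<in>{0..1}.
           \<bar>(\<Sum>i<N. F x (real i / real N)) / real N - integral {0..1} (F x)\<bar> \<le> e"
proof -
  have "uniformly_continuous_on ({0..1} \<times> {0..1}) (\<lambda>(x, t). F x t)"
    by (intro compact_uniformly_continuous cont compact_Times) auto
  then obtain d where d: "d > 0"
    and close: "\<And>x t t'. x \<in> {0..1} \<Longrightarrow> t \<in> {0..1} \<Longrightarrow> t' \<in> {0..1} \<Longrightarrow> \<bar>t - t'\<bar> < d \<Longrightarrow> \<bar>F x t - F x t'\<bar> < e"
    unfolding uniformly_continuous_on_def using e
    by (force simp: dist_Pair_Pair dist_real_def)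
  obtain N0 :: nat where N0: "inverse (real (Suc N0)) < d"
    using reals_Archimedean[OF d] by blast
  have "\<bar>(\<Sum>i<N. F x (real i / real N)) / real N - integral {0..1} (F x)\<bar> \<le> e"
    if N: "N > N0" and x: "x \<in> {0..1}" for N x
  proof -
    have N1: "1 / real N < d"
    proof -
      have "1 / real N \<le> inverse (real (Suc N0))"
        using N by (simp add: field_simps)
      with N0 show ?thesis by linarith
    qed
    have int: "F x integrable_on {c..d}" if "0 \<le> c" "d \<le> 1" for c d
      using x that by (intro integrable_continuous_interval continuous_on_compose2[OF cont, of _ "\<lambda>t. (x, t)", simplified])
        (auto intro!: continuous_intros)
    \<comment> \<open>Induction over the number of cells: each of them adds an error of at most \<open>e / N\<close>.\<close>
    have "\<bar>(\<Sum>i<k. F x (real i / real N)) / real N - integral {0..real k / real N} (F x)\<bar> \<le> e * real k / real N"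
      if "k \<le> N" for k
      using that
    proof (induction k)
      case (Suc k)
      let ?l = "real k / real N" and ?r = "real (Suc k) / real N"
      have lr: "0 \<le> ?l" "?l \<le> ?r" "?r \<le> 1" "?r - ?l = 1 / real N"
        using Suc.prems N by (auto simp: field_simps)
      have split: "integral {0..?r} (F x) = integral {0..?l} (F x) + integral {?l..?r} (F x)"
        using lr by (intro Henstock_Kurzweil_Integration.integral_combine[symmetric] int) auto
      have "((\<lambda>t. F x t - F x ?l) has_integral integral {?l..?r} (F x) - (?r - ?l) *\<^sub>R F x ?l) {?l..?r}"
        using lr has_integral_const_real[of "F x ?l" ?l ?r]
        by (intro has_integral_diff integrable_integral int) auto
      moreover have "norm (F x t - F x ?l) \<le> e" if "t \<in> {?l..?r}" for t
      proof -
        have "\<bar>t - ?l\<bar> < d" "t \<in> {0..1}" "?l \<in> {0..1}"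
          using that lr N1 unfolding atLeastAtMost_iff by linarith+
        then show ?thesis using close[OF x, of t ?l] by simp
      qed
      ultimately have "norm (integral {?l..?r} (F x) - (?r - ?l) *\<^sub>R F x ?l) \<le> e * measure lborel {?l..?r}"
        using e by (intro has_integral_bound_real[of e "{}"]) auto
      then have "\<bar>integral {?l..?r} (F x) - F x ?l / real N\<bar> \<le> e / real N"
        using lr by simp
      moreover have "(\<Sum>i<Suc k. F x (real i / real N)) / real N
          = (\<Sum>i<k. F x (real i / real N)) / real N + F x ?l / real N"
        by (simp add: add_divide_distrib)
      moreover have "e * real (Suc k) / real N = e * real k / real N + e / real N"
        by (simp add: add_divide_distrib distrib_left)
      ultimately show ?case
        using Suc.IH Suc.prems split by linarith
    qed simp
    from this[of N] N show ?thesis by simp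
  qed
  then show ?thesis
    unfolding eventually_sequentially by (intro exI[of _ "Suc N0"]) auto
qed

text \<open>
  The substitution \<open>t = x - u\<close> on the circle, together with the symmetry of the kernel. It identifies
  an average with shifts of \<open>g\<close> with an integral of the kernel functions
  \<open>sep_kernel a t\<close>, that is, with a limit of elements of the Hilbert space.
\<close>

lemma periodic_convolution_eq:
  assumes g: "continuous_on UNIV g" "\<And>x. g (x + 1) = g x" and x: "x \<in> {0..1}"
  shows "integral {0..1} (\<lambda>u. sep_kernel a u 0 * g (x - u)) = integral {0..1} (\<lambda>t. sep_kernel a t x * g t)"
proof -
  let ?\<Psi> = "\<lambda>v. sep_kernel a v 0 * g (x + v)"
  have cont: "continuous_on UNIV ?\<Psi>"
    by (intro continuous_on_mult continuous_sep_kernel continuous_on_compose2[OF g(1)]) (auto intro!: continuous_intros)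
  have per: "?\<Psi> (v + 1) = ?\<Psi> v" for v
    using g(2)[of "x + v"] by (simp add: sep_kernel_period add.assoc)
  have "integral {0..1} (\<lambda>u. sep_kernel a u 0 * g (x - u)) = integral {- 1..0} ?\<Psi>"
    using Henstock_Kurzweil_Integration.integral_reflect_real[of 1 0 "\<lambda>u. sep_kernel a u 0 * g (x - u)"]
    by (simp add: sep_kernel_even)
  also have "\<dots> = integral {- x..1 - x} ?\<Psi>"
    using integral_period_shift[OF cont per, of 1] integral_period_shift[OF cont per, of x] x by simp
  also have "\<dots> = integral {0..1} (\<lambda>t. sep_kernel a t x * g t)"
    using integral_shift_real_ivl[of 0 x 1 "\<lambda>t. sep_kernel a t x * g t"]
    by (simp add: sep_kernel_translation[of a _ x] add.commute)
  finally show ?thesis .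
qed

text \<open>
  A Riemann sum of the convolution integral is a finite combination of kernel functions, so it lies in
  the Hilbert space and its norm is an explicit double sum. With coefficients at most
  \<open>M / (N * sep_mass a)\<close> in absolute value and row sums of the kernel at most \<open>2 * N * sep_mass a\<close>,
  the squared norm is at most \<open>2 * M\<^sup>2 / sep_mass a\<close>.
\<close>

lemma discretised_convolution:
  assumes Z: "sep_mass a > 0" and g: "continuous_on UNIV g" and M: "\<And>x. \<bar>g x\<bar> \<le> M" and \<delta>: "\<delta> > 0"
  shows "\<exists>h\<in>rkhs (sep_kernel a) {0..1}.
           (\<forall>x\<in>{0..1}. \<bar>h x - integral {0..1} (\<lambda>t. sep_kernel a t x * g t) / sep_mass a\<bar> \<le> \<delta>) \<and>
           (rkhs_norm (sep_kernel a) {0..1} h)\<^sup>2 \<le> 2 * M\<^sup>2 / sep_mass a"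
proof -
  let ?K = "sep_kernel a" and ?Z = "sep_mass a"
  have cK: "continuous_on ({0..1} \<times> {0..1}) (\<lambda>(x, t). ?K t x)"
    unfolding sep_kernel_def split_beta by (intro continuous_intros)
  have cKg: "continuous_on ({0..1} \<times> {0..1}) (\<lambda>(x, t). ?K t x * g t)"
    unfolding sep_kernel_def split_beta
    by (intro continuous_intros continuous_on_compose2[OF g]) auto
  have mass: "integral {0..1} (\<lambda>t. ?K t x) = ?Z" if "x \<in> {0..1}" for x
    using periodic_convolution_eq[of "\<lambda>_. 1" x a] that by (simp add: sep_mass_def)
  \<comment> \<open>The second Riemann sum needs no precision: an error of \<open>sep_mass a\<close> merely doubles the row sums.\<close>
  have "\<forall>\<^sub>F N in sequentially. N > 0 \<and>
      (\<forall>x\<in>{0..1}. \<bar>(\<Sum>i<N. ?K (real i / real N) x * g (real i / real N)) / real N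
          - integral {0..1} (\<lambda>t. ?K t x * g t)\<bar> \<le> \<delta> * ?Z) \<and>
      (\<forall>x\<in>{0..1}. \<bar>(\<Sum>i<N. ?K (real i / real N) x) / real N - integral {0..1} (\<lambda>t. ?K t x)\<bar> \<le> ?Z)"
    using Z \<delta> by (intro eventually_conj eventually_gt_at_top
        riemann_sum_uniform[OF cKg] riemann_sum_uniform[OF cK]) auto
  then obtain N :: nat where N: "N > 0"
    and sum_g: "\<And>x. x \<in> {0..1} \<Longrightarrow> \<bar>(\<Sum>i<N. ?K (real i / real N) x * g (real i / real N)) / real N
          - integral {0..1} (\<lambda>t. ?K t x * g t)\<bar> \<le> \<delta> * ?Z"
    and sum_K: "\<And>x. x \<in> {0..1} \<Longrightarrow> (\<Sum>i<N. ?K (real i / real N) x) / real N \<le> 2 * ?Z"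
    using mass by (force simp: eventually_sequentially abs_le_iff)
  define G where "G = (\<lambda>i. real i / real N) ` {..<N}"
  define c where "c s = (if s \<in> G then g s / (real N * ?Z) else 0)" for s
  have G: "finite G" "G \<subseteq> {0..1}" using N by (auto simp: G_def)
  have inj: "inj_on (\<lambda>i. real i / real N) {..<N}" using N by (auto simp: inj_on_def)
  have supp: "{s. c s \<noteq> 0} \<subseteq> G" by (auto simp: c_def)
  have coeffs: "c \<in> coeffs_on {0..1}"
    using G supp by (auto simp: coeffs_on_def intro: finite_subset)
  have comb: "kernel_comb ?K c x = (\<Sum>i<N. ?K (real i / real N) x * g (real i / real N)) / real N / ?Z" for x
  proof -
    have "kernel_comb ?K c x = (\<Sum>s\<in>G. g s / (real N * ?Z) * ?K s x)"
      unfolding kernel_comb_superset[OF G(1) supp] by (simp add: c_def)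
    also have "\<dots> = (\<Sum>i<N. g (real i / real N) / (real N * ?Z) * ?K (real i / real N) x)"
      unfolding G_def by (simp add: sum.reindex[OF inj])
    also have "\<dots> = (\<Sum>i<N. ?K (real i / real N) x * g (real i / real N)) / real N / ?Z"
      by (simp add: sum_divide_distrib mult_ac)
    finally show ?thesis .
  qed
  show ?thesis
  proof (intro bexI conjI ballI)
    show "kernel_comb ?K c \<in> rkhs ?K {0..1}"
      by (rule kernel_comb_in_rkhs[OF coeffs])
    fix x :: real assume x: "x \<in> {0..1}"
    show "\<bar>kernel_comb ?K c x - integral {0..1} (\<lambda>t. ?K t x * g t) / ?Z\<bar> \<le> \<delta>"
      unfolding comb diff_divide_distrib[symmetric] abs_divide
      using sum_g[OF x] Z by (simp add: divide_le_eq)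
  next
    have M0: "0 \<le> M" using M[of 0] by linarith
    let ?q = "M / (real N * ?Z)"
    have c_le: "\<bar>c s\<bar> \<le> ?q" for s
      using M[of s] M0 Z by (auto simp: c_def abs_mult intro!: divide_right_mono)
    have K0: "0 \<le> ?K s t" for s t by (simp add: sep_kernel_def)
    have "(rkhs_norm ?K {0..1} (kernel_comb ?K c))\<^sup>2 = kernel_form ?K c c"
      using kernel_form_nonneg[OF psd_sep_kernel coeffs]
      by (simp add: rkhs_norm_kernel_comb[OF psd_sep_kernel coeffs] kernel_comb_norm_eq)
    also have "\<dots> = (\<Sum>s\<in>G. \<Sum>t\<in>G. c s * c t * ?K s t)"
      by (rule kernel_form_superset[OF G(1) supp supp])
    also have "\<dots> \<le> (\<Sum>s\<in>G. \<Sum>t\<in>G. ?q * ?q * ?K s t)"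
    proof (intro sum_mono mult_right_mono K0)
      fix s t
      have "c s * c t \<le> \<bar>c s\<bar> * \<bar>c t\<bar>" by (metis abs_ge_self abs_mult)
      also have "\<dots> \<le> ?q * ?q" by (intro mult_mono c_le) (use c_le[of 0] in auto)
      finally show "c s * c t \<le> ?q * ?q" .
    qed
    also have "\<dots> = ?q * ?q * (\<Sum>t\<in>G. \<Sum>s\<in>G. ?K s t)"
      by (subst sum.swap) (simp add: sum_distrib_left)
    also have "\<dots> \<le> ?q * ?q * (\<Sum>t\<in>G. real N * (2 * ?Z))"
    proof (intro mult_left_mono sum_mono)
      fix t assume "t \<in> G"
      then have "t \<in> {0..1}" using G by auto
      from sum_K[OF this] show "(\<Sum>s\<in>G. ?K s t) \<le> real N * (2 * ?Z)"
        using N by (simp add: G_def sum.reindex[OF inj] field_simps)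
    qed simp
    also have "\<dots> = ?q * ?q * (real N * (real N * (2 * ?Z)))"
      by (simp add: G_def card_image[OF inj])
    also have "\<dots> = 2 * M\<^sup>2 / ?Z"
      using N Z by (simp add: field_simps power2_eq_square)
    finally show "(rkhs_norm ?K {0..1} (kernel_comb ?K c))\<^sup>2 \<le> 2 * M\<^sup>2 / ?Z" .
  qed
qed

section \<open>Approximation in the Hilbert space\<close>

text \<open>
  The approximation of \<open>F 0\<close> is a discretisation of \<open>F 0 - (residual ^^ Suc n) (F 0)\<close>. The removed
  term is small: \<open>n\<close> of the residuals gain a factor of order \<open>1 / a\<close> each, and the last one gains
  \<open>a powr (- \<beta>)\<close> from the modulus of continuity of \<open>F n\<close>. What remains is the average of the bounded
  function \<open>g\<close>, hence of squared norm of order \<open>1 / sep_mass a\<close>, that is, of order \<open>a\<close>.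
  The summand 1 in the constant pays for the discretisation.
\<close>

lemma periodic_rkhs_approximation:
  fixes F :: "nat \<Rightarrow> real \<Rightarrow> real"
  assumes a: "a \<ge> 1" and \<beta>: "0 < \<beta>" "\<beta> \<le> 1"
    and deriv: "\<And>k x. k < n \<Longrightarrow> (F k has_real_derivative F (Suc k) x) (at x)"
    and per: "\<And>k x. F k (x + 1) = F k x"
    and hoelder: "\<And>x d. 0 \<le> d \<Longrightarrow> d \<le> 1 \<Longrightarrow> \<bar>F n x - F n (x - d)\<bar> \<le> H * d powr \<beta>"
    and M: "\<And>x. \<bar>F 0 x\<bar> \<le> M"
  shows "\<exists>h\<in>rkhs (sep_kernel a) {0..1}.
           (\<forall>x\<in>{0..1}. \<bar>F 0 x - h x\<bar>
              \<le> (exp (pi\<^sup>2) ^ n * (H * (1 + exp (pi\<^sup>2))) + 1) * a powr (- (real n + \<beta>))) \<and>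
           (rkhs_norm (sep_kernel a) {0..1} h)\<^sup>2 \<le> 4 * exp (pi\<^sup>2) * ((\<Sum>j\<le>n. 2 ^ j) * M)\<^sup>2 * a"
proof -
  interpret averaging_kernel "\<lambda>u. sep_kernel a u 0 / sep_mass a"
    by (rule averaging_sep_kernel[OF a])
  note moment = averaging_sep_kernel(2)[OF a] and Z = averaging_sep_kernel(3)[OF a]
  let ?E = "exp (pi\<^sup>2)"
  have cn: "continuous_on UNIV (F n)"
    by (rule continuous_of_backward_modulus[OF hoelder \<beta>(1)])
  have c0: "continuous_on UNIV (F 0)"
  proof (cases n)
    case (Suc m)
    then show ?thesis using deriv[of 0]
      by (intro DERIV_continuous_on[of _ _ "F 1"]) (auto intro: has_field_derivative_at_within)
  qed (use cn in simp)
  have H0: "0 \<le> H" using hoelder[of 1 0] by simp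
  have cp: "continuous_on {0..1} (\<lambda>u::real. min u (1 - u) powr \<beta>)"
    using \<beta> by (intro continuous_on_powr' continuous_intros) auto
  have "\<bar>residual (F n) x\<bar> \<le> H * (1 + ?E) * a powr (- \<beta>)" for x
  proof -
    have "\<bar>residual (F n) x\<bar> \<le> integral {0..1} (\<lambda>u. sep_kernel a u 0 / sep_mass a * (H * min u (1 - u) powr \<beta>))"
      by (intro residual_le_modulus cn continuous_on_mult continuous_on_const cp
          periodic_modulus_wrap[OF per hoelder]) auto
    also have "\<dots> = H * integral {0..1} (\<lambda>u. sep_kernel a u 0 / sep_mass a * min u (1 - u) powr \<beta>)"
      by (subst integral_mult_right[symmetric]) (simp add: mult_ac)
    also have "\<dots> \<le> H * ((1 + ?E) * a powr (- \<beta>))"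
      using a by (intro mult_left_mono[OF _ H0] fractional_moment[OF _ \<beta> moment]) simp
    finally show ?thesis by simp
  qed
  then have "\<bar>(residual ^^ Suc n) (F 0) x\<bar> \<le> (?E / a) ^ n * (H * (1 + ?E) * a powr (- \<beta>))" for x
    by (intro residual_power_le[OF moment deriv per cn]) auto
  also have "(?E / a) ^ n * (H * (1 + ?E) * a powr (- \<beta>)) = ?E ^ n * (H * (1 + ?E)) * a powr (- (real n + \<beta>))"
  proof -
    have "- (real n + \<beta>) = - \<beta> - real n" by simp
    then have "a powr (- (real n + \<beta>)) = a powr (- \<beta>) / a ^ n"
      using a by (simp only: powr_diff) (simp add: powr_realpow)
    then show ?thesis by (simp add: power_divide)
  qed
  finally have small: "\<bar>(residual ^^ Suc n) (F 0) x\<bar> \<le> ?E ^ n * (H * (1 + ?E)) * a powr (- (real n + \<beta>))" for x .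
  define g where "g y = (\<Sum>j<Suc n. (residual ^^ j) (F 0) y)" for y
  have g_cont: "continuous_on UNIV g"
    unfolding g_def by (intro continuous_on_sum continuous_residual_power c0)
  have g_per: "g (x + 1) = g x" for x
    unfolding g_def by (intro sum.cong refl periodic_residual_power per)
  have g_le: "\<bar>g x\<bar> \<le> (\<Sum>j\<le>n. 2 ^ j) * M" for x
  proof -
    have "\<bar>g x\<bar> \<le> (\<Sum>j<Suc n. 2 ^ j * M)"
      unfolding g_def by (intro order_trans[OF sum_abs] sum_mono residual_power_abs_le c0 M)
    then show ?thesis by (simp only: sum_distrib_right lessThan_Suc_atMost)
  qed
  have conv: "F 0 x - (residual ^^ Suc n) (F 0) x = integral {0..1} (\<lambda>t. sep_kernel a t x * g t) / sep_mass a"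
    if x: "x \<in> {0..1}" for x
  proof -
    have "avg g x = integral {0..1} (\<lambda>u. sep_kernel a u 0 * g (x - u)) / sep_mass a"
      unfolding avg_def by (simp flip: integral_divide)
    then show ?thesis
      using minus_residual_power[OF c0, of x "Suc n"] periodic_convolution_eq[OF g_cont g_per x, of a]
      by (simp only: g_def[abs_def])
  qed
  have pos: "0 < a powr (- (real n + \<beta>))" using a by simp
  obtain h where h: "h \<in> rkhs (sep_kernel a) {0..1}"
    and approx: "\<And>x. x \<in> {0..1} \<Longrightarrow>
      \<bar>h x - integral {0..1} (\<lambda>t. sep_kernel a t x * g t) / sep_mass a\<bar> \<le> a powr (- (real n + \<beta>))"
    and norm: "(rkhs_norm (sep_kernel a) {0..1} h)\<^sup>2 \<le> 2 * ((\<Sum>j\<le>n. 2 ^ j) * M)\<^sup>2 / sep_mass a"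
    using discretised_convolution[OF Z g_cont g_le pos] by blast
  show ?thesis
  proof (intro bexI[OF _ h] conjI ballI)
    fix x :: real assume x: "x \<in> {0..1}"
    show "\<bar>F 0 x - h x\<bar> \<le> (?E ^ n * (H * (1 + ?E)) + 1) * a powr (- (real n + \<beta>))"
      unfolding distrib_right using approx[OF x] small[of x] conv[OF x] by linarith
  next
    note norm
    also have "2 * ((\<Sum>j\<le>n. 2 ^ j) * M)\<^sup>2 / sep_mass a
        \<le> 2 * ((\<Sum>j\<le>n. 2 ^ j) * M)\<^sup>2 / (exp (- pi\<^sup>2) / (2 * a))"
      using a Z by (intro divide_left_mono sep_mass_ge) auto
    also have "\<dots> = 4 * ?E * ((\<Sum>j\<le>n. 2 ^ j) * M)\<^sup>2 * a"
      by (simp add: exp_minus field_simps)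
    finally show "(rkhs_norm (sep_kernel a) {0..1} h)\<^sup>2 \<le> 4 * ?E * ((\<Sum>j\<le>n. 2 ^ j) * M)\<^sup>2 * a" .
  qed
qed

lemma holder_order_bounds:
  assumes "\<alpha> > 0"
  shows "0 < \<alpha> - real (holder_order \<alpha>)" "\<alpha> - real (holder_order \<alpha>) \<le> 1"
  using assms unfolding holder_order_def by linarith+

text \<open>
  The derivatives of \<open>w\<close> agree at the two end points, so their periodic extensions form a chain of
  derivatives on the whole line, and the last member keeps its Hoelder exponent.
\<close>

theorem lemma4p4:
  fixes \<alpha> :: real and w :: "real \<Rightarrow> real"
  assumes "\<alpha> > 0"
    and "w \<in> holder_class \<alpha>"
    and "matching_endpoints \<alpha> w"
  shows "\<exists>C D :: real. \<forall>\<^sub>F a in at_top.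
           (INF h \<in> {h \<in> rkhs (sep_kernel a) {0..1}.
                       sup_norm01 (\<lambda>t. w t - h t) \<le> ereal (C * a powr (- \<alpha>))}.
              ereal ((rkhs_norm (sep_kernel a) {0..1} h)\<^sup>2))
           \<le> ereal (D * a)"
proof -
  define n where "n = holder_order \<alpha>"
  define \<beta> where "\<beta> = \<alpha> - real n"
  have \<beta>: "0 < \<beta>" "\<beta> \<le> 1"
    using holder_order_bounds[OF assms(1)] by (simp_all add: \<beta>_def n_def)
  define F where "F k x = deriv01 k w (frac x)" for k x
  have match: "deriv01 k w 0 = deriv01 k w 1" if "k \<le> n" for k
    using assms(3) that by (simp add: matching_endpoints_def n_def)
  have within: "(deriv01 k w has_real_derivative deriv01 (Suc k) w x) (at x within {0..1})"
    if "k < n" "x \<in> {0..1}" for k x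
  proof -
    have "deriv01 k w differentiable (at x within {0..1})"
      using assms(2) that by (simp add: holder_class_def n_def)
    then show ?thesis
      by (simp add: vector_derivative_works has_real_derivative_iff_has_vector_derivative deriv01_def)
  qed
  have deriv: "(F k has_real_derivative F (Suc k) x) (at x)" if "k < n" for k x
    using that unfolding F_def by (intro periodic_extension_has_derivative within match) auto
  have per: "F k (x + 1) = F k x" for k x
    by (simp add: F_def frac_1_eq)
  obtain L where L: "L > 0" and "\<And>x y. x \<in> {0..1} \<Longrightarrow> y \<in> {0..1} \<Longrightarrow>
      \<bar>deriv01 n w x - deriv01 n w y\<bar> \<le> L * \<bar>x - y\<bar> powr \<beta>"
    using assms(2) by (auto simp: holder_class_def n_def \<beta>_def)
  then have hoelder: "\<bar>F n x - F n (x - d)\<bar> \<le> 2 * L * d powr \<beta>" if "0 \<le> d" "d \<le> 1" for x d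
    unfolding F_def using that \<beta> L by (intro periodic_extension_hoelder match) auto
  have c0: "continuous_on UNIV (F 0)"
  proof (cases n)
    case 0
    then show ?thesis
      using continuous_of_backward_modulus[OF hoelder \<beta>(1)] by simp
  next
    case (Suc m)
    then show ?thesis using deriv[of 0]
      by (intro DERIV_continuous_on[of _ _ "F 1"]) (auto intro: has_field_derivative_at_within)
  qed
  then have "bounded (F 0 ` {0..1})"
    by (intro compact_imp_bounded compact_continuous_image continuous_on_subset[OF c0]) auto
  then obtain M where "\<And>y. y \<in> F 0 ` {0..1} \<Longrightarrow> norm y \<le> M"
    unfolding bounded_iff by blast
  then have "\<bar>F 0 x\<bar> \<le> M" if "x \<in> {0..1}" for x
    using that by simp
  then have "\<bar>F 0 (frac x)\<bar> \<le> M" for x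
    using frac_in_unit by blast
  then have M: "\<bar>F 0 x\<bar> \<le> M" for x
    by (simp add: F_def)
  have w: "F 0 x = w x" if "x \<in> {0..1}" for x
    using frac_on_cell[of "deriv01 0 w" x 0] match[of 0] that by (simp add: F_def deriv01_def)
  let ?C = "exp (pi\<^sup>2) ^ n * (2 * L * (1 + exp (pi\<^sup>2))) + 1"
  let ?D = "4 * exp (pi\<^sup>2) * ((\<Sum>j\<le>n. 2 ^ j) * M)\<^sup>2"
  have "(INF h \<in> {h \<in> rkhs (sep_kernel a) {0..1}.
                       sup_norm01 (\<lambda>t. w t - h t) \<le> ereal (?C * a powr (- \<alpha>))}.
              ereal ((rkhs_norm (sep_kernel a) {0..1} h)\<^sup>2)) \<le> ereal (?D * a)" if a: "a \<ge> 1" for a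
  proof -
    obtain h where h: "h \<in> rkhs (sep_kernel a) {0..1}"
      and close: "\<And>x. x \<in> {0..1} \<Longrightarrow> \<bar>F 0 x - h x\<bar> \<le> ?C * a powr (- (real n + \<beta>))"
      and norm: "(rkhs_norm (sep_kernel a) {0..1} h)\<^sup>2 \<le> ?D * a"
      using periodic_rkhs_approximation[OF a \<beta> deriv per hoelder M] by blast
    have "sup_norm01 (\<lambda>t. w t - h t) \<le> ereal (?C * a powr (- \<alpha>))"
      unfolding sup_norm01_def using close w by (intro SUP_least) (simp add: \<beta>_def)
    with h norm show ?thesis
      by (intro INF_lower2[of h]) auto
  qed
  then show ?thesis
    by (intro exI[of _ ?C] exI[of _ ?D] eventually_at_top_linorderI[of 1])
qed

end
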